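(* Let $(X,d)$ be an infinite metric space and let $\mathfrak{B}$ be a bornology on $X$ with closed base, $X\notin\mathfrak{B}$. The following statements are equivalent: (1) $X$ has the $\mathfrak{B}^s$-Hurewicz property. (2) $X$ satisfies $S_{fin}(\mathcal{O}_{\mathfrak{B}^s},\mathcal{O}_{\mathfrak{B}^s}^{gp})$. (3) ONE has no winning strategy in the game $G_{fin}(\mathcal{O}_{\mathfrak{B}^s},\mathcal{O}_{\mathfrak{B}^s}^{gp})$.
   Context: A bornology $\mathfrak{B}$ on $X$ is a family of subsets of $X$ that is closed under finite unions, hereditary (closed under taking subsets), and covers $X$. A base of $\mathfrak{B}$ is a subfamily of $\mathfrak{B}$ cofinal with respect to inclusion; it is closed if all its members are closed in $X$. For $B\in\mathfrak{B}$ and $\delta>0$, $B^\delta=\bigcup_{x\in B}\{y\in X: d(x,y)<\delta\}$. All open covers of $X$ are assumed to be countably infinite. An open $\mathfrak{B}^s$-cover of $X$ is an open cover $\mathcal{U}$ with $X\notin\mathcal{U}$ such that for each $B\in\mathfrak{B}$ there are $U\in\mathcal{U}$ and $\delta>0$ with $B^\delta\subseteq U$; $\mathcal{O}_{\mathfrak{B}^s}$ is the collection of all of these. $X$ has the $\mathfrak{B}^s$-Hurewicz property (strong $\mathfrak{B}$-Hurewicz property) if for each sequence $\{\mathcal{U}_n:n\in\mathbb{N}\}$ of open $\mathfrak{B}^s$-covers of $X$ there is a sequence $\{\mathcal{V}_n:n\in\mathbb{N}\}$, with $\mathcal{V}_n$ a finite subset of $\mathcal{U}_n$ for each $n$, such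 that for every $B\in\mathfrak{B}$ there exist $n_0\in\mathbb{N}$ and a sequence $\{\delta_n:n\ge n_0\}$ of positive reals such that for all $n\ge n_0$, $B^{\delta_n}\subseteq U$ for some $U\in\mathcal{V}_n$. An open cover $\mathcal{U}$ of $X$ is $\mathfrak{B}^s$-groupable if it can be expressed as a union of countably many finite pairwise disjoint sets $\mathcal{U}_n$ such that for each $B\in\mathfrak{B}$ there exist $n_0\in\mathbb{N}$ and a sequence $\{\delta_n:n\ge n_0\}$ of positive reals such that for all $n\ge n_0$, $B^{\delta_n}\subseteq U$ for some $U\in\mathcal{U}_n$; $\mathcal{O}_{\mathfrak{B}^s}^{gp}$ is the collection of all $\mathfrak{B}^s$-groupable covers of $X$. $S_{fin}(\mathcal{A},\mathcal{C})$: for each sequence $\{A_n:n\in\mathbb{N}\}$ of elements of $\mathcal{A}$ there is a sequence $\{B_n:n\in\mathbb{N}\}$ of finite (possibly empty) sets with $B_n\subseteq A_n$ for each $n$ and $\bigcup_{n}B_n\in\mathcal{C}$. $G_{fin}(\mathcal{A},\mathcal{C})$: the infinite game in which in the $n$-th round ONE chooses $A_n\in\mathcal{A}$ and TWO responds with a finite (possibly empty) set $B_n\subseteq A_n$; TWO wins if $\bigcup_n B_n\in\mathcal{C}$, otherwise ONE wins. *)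

theory Defs
  imports "HOL-Analysis.Analysis"
begin

text \<open>
  The metric space \<open>X\<close> is the universe of a type of class \<^class>\<open>metric_space\<close>, so \<open>X\<close> is
  \<^term>\<open>UNIV\<close>, with metric \<^const>\<open>dist\<close>.
\<close>

definition bornology :: "'a set set \<Rightarrow> bool" where
  "bornology \<BB> \<longleftrightarrow>
     (\<forall>A\<in>\<BB>. \<forall>B\<in>\<BB>. A \<union> B \<in> \<BB>) \<and> (\<forall>B\<in>\<BB>. \<forall>A. A \<subseteq> B \<longrightarrow> A \<in> \<BB>) \<and> \<Union>\<BB> = UNIV"

definition bornology_base :: "'a set set \<Rightarrow> 'a set set \<Rightarrow> bool" where
  "bornology_base \<BB> \<BB>\<^sub>0 \<longleftrightarrow> \<BB>\<^sub>0 \<subseteq> \<BB> \<and> (\<forall>B\<in>\<BB>. \<exists>C\<in>\<BB>\<^sub>0. B \<subseteq> C)"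

definition has_closed_base :: "'a::topological_space set set \<Rightarrow> bool" where
  "has_closed_base \<BB> \<longleftrightarrow> (\<exists>\<BB>\<^sub>0. bornology_base \<BB> \<BB>\<^sub>0 \<and> (\<forall>C\<in>\<BB>\<^sub>0. closed C))"

definition enlargement :: "'a::metric_space set \<Rightarrow> real \<Rightarrow> 'a set" where
  "enlargement B \<delta> = (\<Union>x\<in>B. ball x \<delta>)"

text \<open>Open covers are countably infinite by convention.\<close>

definition open_cover :: "'a::topological_space set set \<Rightarrow> bool" where
  "open_cover \<U> \<longleftrightarrow> countable \<U> \<and> infinite \<U> \<and> (\<forall>U\<in>\<U>. open U) \<and> \<Union>\<U> = UNIV"

definition open_Bs_covers :: "'a::metric_space set set \<Rightarrow> 'a set set set" where
  "open_Bs_covers \<BB> =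
     {\<U>. open_cover \<U> \<and> UNIV \<notin> \<U> \<and> (\<forall>B\<in>\<BB>. \<exists>U\<in>\<U>. \<exists>\<delta>>0. enlargement B \<delta> \<subseteq> U)}"

text \<open>
  The condition shared by the Hurewicz property and by groupability. Only the values of \<open>\<delta>\<close>
  at indices \<open>n \<ge> n\<^sub>0\<close> matter, so a total function represents the sequence \<open>\<delta>\<^sub>n\<close>, \<open>n \<ge> n\<^sub>0\<close>.
\<close>

definition eventually_Bs_covers :: "'a::metric_space set set \<Rightarrow> (nat \<Rightarrow> 'a set set) \<Rightarrow> bool" where
  "eventually_Bs_covers \<BB> \<V> \<longleftrightarrow>
     (\<forall>B\<in>\<BB>. \<exists>n\<^sub>0. \<exists>\<delta>::nat \<Rightarrow> real. (\<forall>n\<ge>n\<^sub>0. \<delta> n > 0) \<and>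
        (\<forall>n\<ge>n\<^sub>0. \<exists>U\<in>\<V> n. enlargement B (\<delta> n) \<subseteq> U))"

definition Bs_Hurewicz :: "'a::metric_space set set \<Rightarrow> bool" where
  "Bs_Hurewicz \<BB> \<longleftrightarrow>
     (\<forall>\<U>::nat \<Rightarrow> 'a set set. (\<forall>n. \<U> n \<in> open_Bs_covers \<BB>) \<longrightarrow>
        (\<exists>\<V>. (\<forall>n. finite (\<V> n) \<and> \<V> n \<subseteq> \<U> n) \<and> eventually_Bs_covers \<BB> \<V>))"

definition Bs_groupable_covers :: "'a::metric_space set set \<Rightarrow> 'a set set set" where
  "Bs_groupable_covers \<BB> =
     {\<U>. open_cover \<U> \<and>
        (\<exists>\<G>::nat \<Rightarrow> 'a set set. \<U> = (\<Union>n. \<G> n) \<and> (\<forall>n. finite (\<G> n)) \<and>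
           disjoint_family \<G> \<and> eventually_Bs_covers \<BB> \<G>)}"

definition S_fin :: "'b set set \<Rightarrow> 'b set set \<Rightarrow> bool" where
  "S_fin \<A> \<C> \<longleftrightarrow>
     (\<forall>A::nat \<Rightarrow> 'b set. (\<forall>n. A n \<in> \<A>) \<longrightarrow>
        (\<exists>B. (\<forall>n. finite (B n) \<and> B n \<subseteq> A n) \<and> (\<Union>n. B n) \<in> \<C>))"

text \<open>
  In the game \<open>G\<^sub>f\<^sub>i\<^sub>n(\<A>, \<C>)\<close> a strategy of ONE is a function \<open>\<sigma>\<close> from the finite list of TWO's
  previous moves to ONE's next move; ONE's own previous moves are determined by \<open>\<sigma>\<close> and that
  list. ONE must have a legal move, that is, an element of \<open>\<A>\<close>, at every position that can
  arise when ONE follows \<open>\<sigma>\<close>.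
\<close>

definition G_fin_position :: "('b set list \<Rightarrow> 'b set) \<Rightarrow> 'b set list \<Rightarrow> bool" where
  "G_fin_position \<sigma> Bs \<longleftrightarrow> (\<forall>i<length Bs. finite (Bs ! i) \<and> Bs ! i \<subseteq> \<sigma> (take i Bs))"

definition G_fin_strategy_ONE :: "'b set set \<Rightarrow> ('b set list \<Rightarrow> 'b set) \<Rightarrow> bool" where
  "G_fin_strategy_ONE \<A> \<sigma> \<longleftrightarrow> (\<forall>Bs. G_fin_position \<sigma> Bs \<longrightarrow> \<sigma> Bs \<in> \<A>)"

definition G_fin_play :: "('b set list \<Rightarrow> 'b set) \<Rightarrow> (nat \<Rightarrow> 'b set) \<Rightarrow> bool" where
  "G_fin_play \<sigma> B \<longleftrightarrow> (\<forall>n. finite (B n) \<and> B n \<subseteq> \<sigma> (map B [0..<n]))"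

definition G_fin_winning_ONE ::
  "'b set set \<Rightarrow> 'b set set \<Rightarrow> ('b set list \<Rightarrow> 'b set) \<Rightarrow> bool" where
  "G_fin_winning_ONE \<A> \<C> \<sigma> \<longleftrightarrow>
     G_fin_strategy_ONE \<A> \<sigma> \<and> (\<forall>B. G_fin_play \<sigma> B \<longrightarrow> (\<Union>n. B n) \<notin> \<C>)"

end

theory Submission
  imports Defs
begin

text \<open>
  The three statements are proved in a cycle; the real content is that the Hurewicz property
  defeats every strategy of ONE. Covers are countable, so a strategy of ONE has only countably many
  positions, because TWO always answers with a finite set. Hence a \<^emph>\<open>single\<close> application of the
  Hurewicz property, to the family of all covers that the strategy could ever play, yields a
  finite answer at every position such that each \<open>B \<in> \<BB>\<close> is handled by all answers except
  finitely many. When TWO follows these answers, the positions visited are pairwise distinct,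
  so \<open>B\<close> is handled in all rounds from some point on. To make TWO's moves pairwise disjoint, the
  sets that TWO has already chosen are first deleted from ONE's cover. This is harmless
  (\<open>open_Bs_covers_Diff_finite\<close>): adding to \<open>B\<close> one point outside each of finitely many
  proper subsets of \<open>X\<close> gives a member of \<open>\<BB>\<close> that none of them contains.

  If the selection principle failed for some sequence of covers, ONE would win by playing this
  sequence regardless of TWO's moves. Finally, given the selection principle and covers \<open>\<U>\<^sub>n\<close>,
  apply it to the common refinements \<open>\<W>\<^sub>n\<close> of \<open>\<U>\<^sub>0, \<dots>, \<U>\<^sub>n\<close>. The groups of the resulting
  cover are disjoint, so all but finitely many of them avoid the finitely many sets selected
  from \<open>\<W>\<^sub>0, \<dots>, \<W>\<^sub>n\<close>. Such a group refines \<open>\<U>\<^sub>n\<close>, and it is replaced by a finite subset of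
  \<open>\<U>\<^sub>n\<close>.
\<close>

section \<open>Uniform containment\<close>

definition uniformly_inside :: "'a::metric_space set \<Rightarrow> 'a set \<Rightarrow> bool" where
  "uniformly_inside B U \<longleftrightarrow> (\<exists>\<delta>>0. enlargement B \<delta> \<subseteq> U)"

lemma enlargement_mono: "B \<subseteq> C \<Longrightarrow> \<delta> \<le> \<epsilon> \<Longrightarrow> enlargement B \<delta> \<subseteq> enlargement C \<epsilon>"
  unfolding enlargement_def by force

lemma uniformly_inside_subset: "uniformly_inside B U \<Longrightarrow> B \<subseteq> U"
  unfolding uniformly_inside_def enlargement_def by force

lemma uniformly_inside_mono:
  "uniformly_inside C U \<Longrightarrow> B \<subseteq> C \<Longrightarrow> U \<subseteq> V \<Longrightarrow> uniformly_inside B V"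
  unfolding uniformly_inside_def by (meson enlargement_mono order_refl order_trans)

lemma uniformly_inside_Int:
  assumes "uniformly_inside B U" "uniformly_inside B V"
  shows "uniformly_inside B (U \<inter> V)"
proof -
  obtain \<delta> \<epsilon> where "\<delta> > 0" "enlargement B \<delta> \<subseteq> U" "\<epsilon> > 0" "enlargement B \<epsilon> \<subseteq> V"
    using assms unfolding uniformly_inside_def by blast
  then have "min \<delta> \<epsilon> > 0 \<and> enlargement B (min \<delta> \<epsilon>) \<subseteq> U \<inter> V"
    using enlargement_mono[of B B "min \<delta> \<epsilon>" \<delta>] enlargement_mono[of B B "min \<delta> \<epsilon>" \<epsilon>] by auto
  then show ?thesis unfolding uniformly_inside_def by blast
qed

lemma eventually_Bs_covers_iff:
  "eventually_Bs_covers \<BB> \<V> \<longleftrightarrow>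
     (\<forall>B\<in>\<BB>. \<forall>\<^sub>F n in sequentially. \<exists>U\<in>\<V> n. uniformly_inside B U)"
proof -
  have "(\<exists>\<delta>::nat \<Rightarrow> real. (\<forall>n\<ge>m. \<delta> n > 0) \<and> (\<forall>n\<ge>m. \<exists>U\<in>\<V> n. enlargement B (\<delta> n) \<subseteq> U))
      \<longleftrightarrow> (\<forall>n\<ge>m. \<exists>U\<in>\<V> n. uniformly_inside B U)" (is "?L \<longleftrightarrow> ?R") for B m
  proof
    assume ?L
    then show ?R unfolding uniformly_inside_def by metis
  next
    assume ?R
    then have "\<forall>n. \<exists>\<delta>. m \<le> n \<longrightarrow> \<delta> > 0 \<and> (\<exists>U\<in>\<V> n. enlargement B \<delta> \<subseteq> U)"
      unfolding uniformly_inside_def by metis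
    from choice[OF this] obtain \<delta> :: "nat \<Rightarrow> real"
      where "\<forall>n. m \<le> n \<longrightarrow> \<delta> n > 0 \<and> (\<exists>U\<in>\<V> n. enlargement B (\<delta> n) \<subseteq> U)" ..
    then show ?L by (intro exI[of _ \<delta>]) simp
  qed
  then show ?thesis
    unfolding eventually_Bs_covers_def eventually_sequentially by (simp only:)
qed

section \<open>Covers relative to a bornology\<close>

lemma bornology_Un: "bornology \<BB> \<Longrightarrow> A \<in> \<BB> \<Longrightarrow> B \<in> \<BB> \<Longrightarrow> A \<union> B \<in> \<BB>"
  unfolding bornology_def by blast

lemma bornology_singleton: "bornology \<BB> \<Longrightarrow> {x} \<in> \<BB>"
  unfolding bornology_def by (metis UNIV_I UnionE empty_subsetI insert_subset)

lemma bornology_Un_finite: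
  assumes "bornology \<BB>" "B \<in> \<BB>" "finite F"
  shows "B \<union> F \<in> \<BB>"
  using assms(3)
proof induction
  case empty
  then show ?case using assms(2) by simp
next
  case (insert x F)
  have "(B \<union> F) \<union> {x} \<in> \<BB>"
    by (intro bornology_Un bornology_singleton assms(1) insert.IH)
  then show ?case by simp
qed

text \<open>
  One extra point for each proper subset suffices, and \<open>\<BB>\<close> absorbs finitely many points. This
  is why a cover that handles all of \<open>\<BB>\<close> is infinite and survives the loss of finitely many
  members.
\<close>

lemma bornology_escape_finite:
  assumes "bornology \<BB>" "B \<in> \<BB>" "finite F" "UNIV \<notin> F"
  obtains C where "C \<in> \<BB>" "B \<subseteq> C" "\<And>U. U \<in> F \<Longrightarrow> \<not> C \<subseteq> U"
proof -
  have "\<forall>U. \<exists>x. U \<in> F \<longrightarrow> x \<notin> U" using assms(4) by (metis UNIV_eq_I)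
  then obtain x where x: "\<And>U. U \<in> F \<Longrightarrow> x U \<notin> U" by metis
  show thesis
  proof
    show "B \<union> x ` F \<in> \<BB>" using assms by (intro bornology_Un_finite) auto
  qed (use x in auto)
qed

text \<open>
  Infinitude and covering need not be checked: singletons are in \<open>\<BB>\<close>, and a finite family of
  proper subsets misses some member of \<open>\<BB>\<close>.
\<close>

lemma open_Bs_covers_iff:
  assumes "bornology \<BB>"
  shows "\<U> \<in> open_Bs_covers \<BB> \<longleftrightarrow> countable \<U> \<and> (\<forall>U\<in>\<U>. open U) \<and> UNIV \<notin> \<U> \<and>
           (\<forall>B\<in>\<BB>. \<exists>U\<in>\<U>. uniformly_inside B U)" (is "?L \<longleftrightarrow> ?R")
proof
  assume ?L
  then show ?R unfolding open_Bs_covers_def open_cover_def uniformly_inside_def by blast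
next
  assume R: ?R
  then have inside: "\<exists>U\<in>\<U>. B \<subseteq> U" if "B \<in> \<BB>" for B
    using that uniformly_inside_subset by blast
  have "infinite \<U>"
  proof
    assume "finite \<U>"
    moreover have "{undefined} \<in> \<BB>" by (rule bornology_singleton[OF assms])
    ultimately obtain C where "C \<in> \<BB>" "\<And>U. U \<in> \<U> \<Longrightarrow> \<not> C \<subseteq> U"
      using bornology_escape_finite[OF assms] R by metis
    then show False using inside by blast
  qed
  moreover have "\<Union>\<U> = UNIV"
    using inside[OF bornology_singleton[OF assms]] by blast
  ultimately show ?L
    using R unfolding open_Bs_covers_def open_cover_def uniformly_inside_def by blast
qed

lemma open_Bs_covers_Diff_finite:
  assumes "bornology \<BB>" "\<U> \<in> open_Bs_covers \<BB>" "finite F"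
  shows "\<U> - F \<in> open_Bs_covers \<BB>"
proof -
  have \<U>: "countable \<U>" "\<forall>U\<in>\<U>. open U" "UNIV \<notin> \<U>" "\<forall>B\<in>\<BB>. \<exists>U\<in>\<U>. uniformly_inside B U"
    using assms open_Bs_covers_iff by blast+
  have "\<exists>U\<in>\<U> - F. uniformly_inside B U" if B: "B \<in> \<BB>" for B
  proof -
    obtain C where C: "C \<in> \<BB>" "B \<subseteq> C" "\<And>U. U \<in> \<U> \<inter> F \<Longrightarrow> \<not> C \<subseteq> U"
      using bornology_escape_finite[OF assms(1) B, of "\<U> \<inter> F"] \<U>(3) assms(3) by auto
    obtain U where U: "U \<in> \<U>" "uniformly_inside C U" using \<U>(4) C(1) by blast
    then have "U \<notin> F" using C(3) uniformly_inside_subset by blast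
    then show ?thesis using U C(2) uniformly_inside_mono by blast
  qed
  then show ?thesis using \<U> by (simp add: open_Bs_covers_iff[OF assms(1)])
qed

lemma open_Bs_covers_meet:
  assumes "bornology \<BB>" "\<U> \<in> open_Bs_covers \<BB>" "\<V> \<in> open_Bs_covers \<BB>"
  shows "(\<lambda>(U, V). U \<inter> V) ` (\<U> \<times> \<V>) \<in> open_Bs_covers \<BB>"
proof -
  let ?W = "(\<lambda>(U, V). U \<inter> V) ` (\<U> \<times> \<V>)"
  have "\<exists>W\<in>?W. uniformly_inside B W" if B: "B \<in> \<BB>" for B
  proof -
    obtain U V where "U \<in> \<U>" "uniformly_inside B U" "V \<in> \<V>" "uniformly_inside B V"
      using B assms open_Bs_covers_iff by metis
    then have "uniformly_inside B (U \<inter> V)" "U \<inter> V \<in> ?W"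
      using uniformly_inside_Int by auto
    then show ?thesis ..
  qed
  then show ?thesis
    using assms(2,3) unfolding open_Bs_covers_iff[OF assms(1)] by auto
qed

text \<open>
  The families themselves are the groups. Handling a singleton forces almost all of them to be
  nonempty, and being disjoint they then have an infinite union.
\<close>

lemma groupable_if_eventually_Bs_covers:
  assumes "bornology \<BB>"
    and fin: "\<And>n. finite (\<G> n)" and "disjoint_family \<G>"
    and "\<And>n U. U \<in> \<G> n \<Longrightarrow> open U"
    and ev: "eventually_Bs_covers \<BB> \<G>"
  shows "(\<Union>n. \<G> n) \<in> Bs_groupable_covers \<BB>"
proof -
  have ev_pt: "\<forall>\<^sub>F n in sequentially. \<exists>U\<in>\<G> n. x \<in> U" for x
  proof -
    have "\<forall>\<^sub>F n in sequentially. \<exists>U\<in>\<G> n. uniformly_inside {x} U"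
      using ev bornology_singleton[OF assms(1)] unfolding eventually_Bs_covers_iff by blast
    then show ?thesis
      by (rule eventually_mono) (use uniformly_inside_subset in blast)
  qed
  have "infinite (\<Union>n. \<G> n)"
  proof
    assume finU: "finite (\<Union>n. \<G> n)"
    obtain N where N: "\<And>n. n \<ge> N \<Longrightarrow> \<G> n \<noteq> {}"
      using ev_pt[of undefined] unfolding eventually_sequentially by blast
    then have "\<forall>n. \<exists>U. U \<in> \<G> (N + n)" by (meson ex_in_conv le_add1)
    then obtain f where f: "\<And>n. f n \<in> \<G> (N + n)" by metis
    have "inj f"
    proof
      fix m n assume "f m = f n"
      then have "\<G> (N + m) \<inter> \<G> (N + n) \<noteq> {}" using f[of m] f[of n] by auto
      then have "N + m = N + n" using assms(3) unfolding disjoint_family_on_def by blast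
      then show "m = n" by simp
    qed
    moreover have "range f \<subseteq> (\<Union>n. \<G> n)" using f by blast
    ultimately show False using finU finite_subset range_inj_infinite by metis
  qed
  moreover have "countable (\<Union>n. \<G> n)" using fin by (simp add: countable_finite)
  moreover have "x \<in> \<Union>(\<Union>n. \<G> n)" for x
    using eventually_happens'[OF sequentially_bot ev_pt[of x]] by blast
  ultimately have "open_cover (\<Union>n. \<G> n)"
    using assms(4) unfolding open_cover_def by blast
  then show ?thesis using assms(2,3,5) unfolding Bs_groupable_covers_def by blast
qed

section \<open>From selection to the Hurewicz property\<close>

primrec iterated_meet :: "(nat \<Rightarrow> 'a set set) \<Rightarrow> nat \<Rightarrow> 'a set set" where
  "iterated_meet \<U> 0 = \<U> 0"
| "iterated_meet \<U> (Suc n) = (\<lambda>(U, V). U \<inter> V) ` (iterated_meet \<U> n \<times> \<U> (Suc n))"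

lemma iterated_meet_open_Bs_covers:
  assumes "bornology \<BB>" "\<And>n. \<U> n \<in> open_Bs_covers \<BB>"
  shows "iterated_meet \<U> n \<in> open_Bs_covers \<BB>"
proof (induction n)
  case 0
  then show ?case using assms by simp
next
  case (Suc n)
  then show ?case using open_Bs_covers_meet[OF assms(1) Suc assms(2)[of "Suc n"]] by simp
qed

lemma iterated_meet_refines:
  "W \<in> iterated_meet \<U> m \<Longrightarrow> n \<le> m \<Longrightarrow> \<exists>U\<in>\<U> n. W \<subseteq> U"
proof (induction m arbitrary: W)
  case 0
  then show ?case by auto
next
  case (Suc m)
  then obtain U V where W: "W = U \<inter> V" "U \<in> iterated_meet \<U> m" "V \<in> \<U> (Suc m)" by auto
  show ?case
  proof (cases "n = Suc m")
    case True
    then show ?thesis using W by blast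
  next
    case False
    then obtain U' where "U' \<in> \<U> n" "U \<subseteq> U'" using Suc.IH W(2) Suc.prems(2) by fastforce
    then show ?thesis using W(1) by blast
  qed
qed

lemma disjoint_family_eventually_avoids_finite:
  assumes "disjoint_family \<G>" "finite F"
  shows "\<forall>\<^sub>F k::nat in sequentially. \<G> k \<inter> F = {}"
proof -
  have "\<forall>\<^sub>F k in sequentially. x \<notin> \<G> k" for x
  proof (cases "\<exists>m. x \<in> \<G> m")
    case True
    then obtain m where "x \<in> \<G> m" ..
    moreover have "\<G> m \<inter> \<G> k = {}" if "k > m" for k
      using that assms(1) unfolding disjoint_family_on_def by simp
    ultimately have "x \<notin> \<G> k" if "k > m" for k
      using that by blast
    then show ?thesis by (meson eventually_at_top_dense)
  qed simp
  then have "\<forall>\<^sub>F k in sequentially. \<forall>x\<in>F. x \<notin> \<G> k"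
    using assms(2) by (simp add: eventually_ball_finite)
  then show ?thesis by (rule eventually_mono) blast
qed

lemma Bs_Hurewicz_if_S_fin:
  assumes "bornology \<BB>" "S_fin (open_Bs_covers \<BB>) (Bs_groupable_covers \<BB>)"
  shows "Bs_Hurewicz \<BB>"
  unfolding Bs_Hurewicz_def
proof (intro allI impI)
  fix \<U> :: "nat \<Rightarrow> 'a set set"
  assume "\<forall>n. \<U> n \<in> open_Bs_covers \<BB>"
  then have "\<forall>n. iterated_meet \<U> n \<in> open_Bs_covers \<BB>"
    using iterated_meet_open_Bs_covers assms(1) by blast
  then obtain S where S: "\<And>n. finite (S n)" "\<And>n. S n \<subseteq> iterated_meet \<U> n"
    "(\<Union>n. S n) \<in> Bs_groupable_covers \<BB>"
    using assms(2) unfolding S_fin_def by meson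
  then obtain \<G> where \<G>: "(\<Union>n. S n) = (\<Union>n. \<G> n)" "\<And>n. finite (\<G> n)"
    "disjoint_family \<G>" "eventually_Bs_covers \<BB> \<G>"
    unfolding Bs_groupable_covers_def by auto
  \<comment> \<open>The bound \<open>k \<ge> n\<close> lets the chosen groups run off to infinity with \<open>n\<close>.\<close>
  have "\<exists>k\<ge>n. \<G> k \<inter> (\<Union>i<n. S i) = {}" for n
    using disjoint_family_eventually_avoids_finite[OF \<G>(3), of "\<Union>i<n. S i"] S(1)
    unfolding eventually_sequentially by (metis finite_UN finite_lessThan nat_le_linear)
  then obtain k where k: "\<And>n. k n \<ge> n" "\<And>n. \<G> (k n) \<inter> (\<Union>i<n. S i) = {}" by metis
  have "\<exists>U\<in>\<U> n. W \<subseteq> U" if W: "W \<in> \<G> (k n)" for n W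
  proof -
    obtain m where m: "W \<in> S m" using W \<G>(1) by blast
    then have "n \<le> m" using k(2)[of n] W by (meson UN_I disjoint_iff lessThan_iff not_le)
    then show ?thesis using m S(2) iterated_meet_refines by blast
  qed
  then have "\<forall>n W. \<exists>U. W \<in> \<G> (k n) \<longrightarrow> U \<in> \<U> n \<and> W \<subseteq> U" by blast
  then obtain f where f: "\<And>n W. W \<in> \<G> (k n) \<Longrightarrow> f n W \<in> \<U> n \<and> W \<subseteq> f n W" by metis
  define \<V> where "\<V> n = f n ` \<G> (k n)" for n
  have "\<forall>\<^sub>F n in sequentially. \<exists>U\<in>\<V> n. uniformly_inside B U" if "B \<in> \<BB>" for B
  proof -
    have "\<forall>\<^sub>F n in sequentially. \<exists>U\<in>\<G> n. uniformly_inside B U"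
      using \<G>(4) that unfolding eventually_Bs_covers_iff by blast
    then obtain N where N: "\<And>n. n \<ge> N \<Longrightarrow> \<exists>U\<in>\<G> n. uniformly_inside B U"
      unfolding eventually_sequentially by blast
    have "\<exists>U\<in>\<V> n. uniformly_inside B U" if "n \<ge> N" for n
    proof -
      have "k n \<ge> N" using that k(1)[of n] by simp
      then obtain W where W: "W \<in> \<G> (k n)" "uniformly_inside B W" using N by blast
      then have "uniformly_inside B (f n W)" using f uniformly_inside_mono by blast
      then show ?thesis using W(1) unfolding \<V>_def by blast
    qed
    then show ?thesis unfolding eventually_sequentially by blast
  qed
  then have "eventually_Bs_covers \<BB> \<V>" unfolding eventually_Bs_covers_iff by blast
  moreover have "\<forall>n. finite (\<V> n) \<and> \<V> n \<subseteq> \<U> n" unfolding \<V>_def using \<G>(2) f by auto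
  ultimately show "\<exists>\<V>. (\<forall>n. finite (\<V> n) \<and> \<V> n \<subseteq> \<U> n) \<and> eventually_Bs_covers \<BB> \<V>" by blast
qed

section \<open>Strategies of ONE\<close>

text \<open>
  A sequence of members of \<open>\<A>\<close> is a strategy of ONE that ignores TWO's moves, and its plays
  are exactly the selections from the sequence.
\<close>

lemma S_fin_if_no_winning_strategy:
  assumes "\<not> (\<exists>\<sigma>. G_fin_winning_ONE \<A> \<C> \<sigma>)"
  shows "S_fin \<A> \<C>"
  unfolding S_fin_def
proof (intro allI impI)
  fix A :: "nat \<Rightarrow> 'a set"
  assume "\<forall>n. A n \<in> \<A>"
  then have "G_fin_strategy_ONE \<A> (\<lambda>Bs. A (length Bs))" unfolding G_fin_strategy_ONE_def by blast
  then obtain B where "G_fin_play (\<lambda>Bs. A (length Bs)) B" "(\<Union>n. B n) \<in> \<C>"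
    using assms unfolding G_fin_winning_ONE_def by blast
  then show "\<exists>B. (\<forall>n. finite (B n) \<and> B n \<subseteq> A n) \<and> (\<Union>n. B n) \<in> \<C>"
    unfolding G_fin_play_def by auto
qed

lemma G_fin_position_Nil: "G_fin_position \<sigma> []"
  unfolding G_fin_position_def by simp

lemma G_fin_position_snoc:
  "G_fin_position \<sigma> (Bs @ [F]) \<longleftrightarrow> G_fin_position \<sigma> Bs \<and> finite F \<and> F \<subseteq> \<sigma> Bs"
  unfolding G_fin_position_def by (auto simp: less_Suc_eq nth_append)

lemma G_fin_position_finite: "G_fin_position \<sigma> Bs \<Longrightarrow> finite (\<Union>(set Bs))"
  unfolding G_fin_position_def by (metis finite_Union in_set_conv_nth List.finite_set)

lemma countable_G_fin_positions:
  assumes "\<And>Bs. G_fin_position \<sigma> Bs \<Longrightarrow> countable (\<sigma> Bs)"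
  shows "countable {Bs. G_fin_position \<sigma> Bs}"
proof -
  have "countable {Bs. G_fin_position \<sigma> Bs \<and> length Bs = n}" (is "countable (?P n)") for n
  proof (induction n)
    case 0
    then show ?case by (rule countable_subset[of _ "{[]}"]) auto
  next
    case (Suc n)
    let ?Q = "\<Union>Bs\<in>?P n. (\<lambda>F. Bs @ [F]) ` {F. finite F \<and> F \<subseteq> \<sigma> Bs}"
    have "?P (Suc n) \<subseteq> ?Q"
    proof
      fix Bs assume Bs: "Bs \<in> ?P (Suc n)"
      then obtain Cs F where "Bs = Cs @ [F]" by (cases Bs rule: rev_cases) auto
      then show "Bs \<in> ?Q" using Bs by (auto simp: G_fin_position_snoc)
    qed
    moreover have "countable ?Q"
      using Suc assms by (intro countable_UN countable_image countable_Collect_finite_subset) auto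
    ultimately show ?case by (rule countable_subset)
  qed
  then have "countable (\<Union>n. ?P n)" by blast
  moreover have "(\<Union>n. ?P n) = {Bs. G_fin_position \<sigma> Bs}" by blast
  ultimately show ?thesis by simp
qed

text \<open>
  The play is built by recursion on positions rather than on moves, because the reply in a round
  depends on the whole list of earlier moves.
\<close>

lemma G_fin_play_from_replies:
  assumes "\<And>Bs. G_fin_position \<sigma> Bs \<Longrightarrow> finite (\<tau> Bs) \<and> \<tau> Bs \<subseteq> \<sigma> Bs"
  obtains B where "G_fin_play \<sigma> B" "\<And>n. B n = \<tau> (map B [0..<n])"
    "\<And>n. G_fin_position \<sigma> (map B [0..<n])"
proof -
  define p where "p = rec_nat [] (\<lambda>_ Bs. Bs @ [\<tau> Bs])"
  define B where "B n = \<tau> (p n)" for n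
  have p_map: "p n = map B [0..<n]" for n
    by (induction n) (simp_all add: p_def B_def)
  have pos: "G_fin_position \<sigma> (p n)" for n
    by (induction n) (use assms in \<open>simp_all add: p_def G_fin_position_Nil G_fin_position_snoc\<close>)
  show thesis
  proof
    show "G_fin_play \<sigma> B"
      using assms[OF pos] unfolding G_fin_play_def by (simp add: B_def flip: p_map)
    show "B n = \<tau> (map B [0..<n])" for n by (simp add: B_def flip: p_map)
    show "G_fin_position \<sigma> (map B [0..<n])" for n using pos by (simp flip: p_map)
  qed
qed

lemma eventually_sequentially_inj:
  fixes f :: "nat \<Rightarrow> nat"
  assumes "inj f" "eventually P sequentially"
  shows "\<forall>\<^sub>F n in sequentially. P (f n)"
proof -
  have "finite (f -` {i. \<not> P i})"
    using assms
    by (intro finite_vimageI) (simp_all flip: cofinite_eq_sequentially add: eventually_cofinite)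
  then show ?thesis by (simp flip: cofinite_eq_sequentially add: eventually_cofinite vimage_def)
qed

lemma TWO_beats_strategy_if_Bs_Hurewicz:
  assumes "bornology \<BB>" "Bs_Hurewicz \<BB>" "G_fin_strategy_ONE (open_Bs_covers \<BB>) \<sigma>"
  obtains B where "G_fin_play \<sigma> B" "(\<Union>n. B n) \<in> Bs_groupable_covers \<BB>"
proof -
  let ?P = "{Bs. G_fin_position \<sigma> Bs}"
  have cover: "\<sigma> Bs \<in> open_Bs_covers \<BB>" if "Bs \<in> ?P" for Bs
    using that assms(3) unfolding G_fin_strategy_ONE_def by blast
  then have "countable (\<sigma> Bs)" if "Bs \<in> ?P" for Bs
    using that open_Bs_covers_iff[OF assms(1)] by blast
  then have count: "countable ?P" by (intro countable_G_fin_positions) simp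
  have ne: "?P \<noteq> {}" using G_fin_position_Nil by blast
  define rest where "rest Bs = \<sigma> Bs - \<Union>(set Bs)" for Bs
  have "rest Bs \<in> open_Bs_covers \<BB>" if "Bs \<in> ?P" for Bs
    unfolding rest_def using that assms(1) cover G_fin_position_finite
    by (intro open_Bs_covers_Diff_finite) auto
  then have "\<forall>i. rest (from_nat_into ?P i) \<in> open_Bs_covers \<BB>"
    using from_nat_into[OF ne] by blast
  then obtain \<V> where \<V>: "\<And>i. finite (\<V> i)" "\<And>i. \<V> i \<subseteq> rest (from_nat_into ?P i)"
    "eventually_Bs_covers \<BB> \<V>"
    using assms(2)[unfolded Bs_Hurewicz_def, rule_format, of "\<lambda>i. rest (from_nat_into ?P i)"]
    by blast
  define \<tau> where "\<tau> Bs = \<V> (to_nat_on ?P Bs)" for Bs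
  have \<tau>: "finite (\<tau> Bs)" "\<tau> Bs \<subseteq> rest Bs" if "G_fin_position \<sigma> Bs" for Bs
    using that \<V>(1) \<V>(2)[of "to_nat_on ?P Bs"] count unfolding \<tau>_def by simp_all
  then have "finite (\<tau> Bs) \<and> \<tau> Bs \<subseteq> \<sigma> Bs" if "G_fin_position \<sigma> Bs" for Bs
    using that unfolding rest_def by blast
  then obtain B where B: "G_fin_play \<sigma> B" "\<And>n. B n = \<tau> (map B [0..<n])"
    and pos: "\<And>n. G_fin_position \<sigma> (map B [0..<n])"
    using G_fin_play_from_replies[of \<sigma> \<tau>] by metis
  have B_rest: "B n \<subseteq> \<sigma> (map B [0..<n]) - (\<Union>i<n. B i)" for n
    using \<tau>(2)[OF pos[of n]] B(2)[of n] unfolding rest_def by auto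
  \<comment> \<open>Positions of different rounds have different lengths, so their indices are distinct.\<close>
  have "inj (\<lambda>n. to_nat_on ?P (map B [0..<n]))"
  proof
    fix m n assume "to_nat_on ?P (map B [0..<m]) = to_nat_on ?P (map B [0..<n])"
    then have "map B [0..<m] = map B [0..<n]" using count pos by simp
    then show "m = n" by (metis diff_zero length_map length_upt)
  qed
  moreover have "B n = \<V> (to_nat_on ?P (map B [0..<n]))" for n
    using B(2) unfolding \<tau>_def by blast
  ultimately have "eventually_Bs_covers \<BB> B"
    using \<V>(3) eventually_sequentially_inj unfolding eventually_Bs_covers_iff by fastforce
  moreover have "disjoint_family B"
  proof -
    have "B m \<inter> B n = {}" if "m < n" for m n using B_rest[of n] that by blast
    then show ?thesis unfolding disjoint_family_on_def by (metis Int_commute nat_neq_iff)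
  qed
  moreover have "open U" if "U \<in> B n" for n U
    using that B_rest[of n] cover[of "map B [0..<n]"] pos open_Bs_covers_iff[OF assms(1)] by blast
  moreover have "finite (B n)" for n using B(1) unfolding G_fin_play_def by blast
  ultimately have "(\<Union>n. B n) \<in> Bs_groupable_covers \<BB>"
    using groupable_if_eventually_Bs_covers[OF assms(1)] by blast
  then show thesis using that B(1) by blast
qed

theorem theorem4p2:
  fixes \<BB> :: "'a::metric_space set set"
  assumes "infinite (UNIV :: 'a set)"
    and "bornology \<BB>"
    and "has_closed_base \<BB>"
    and "UNIV \<notin> \<BB>"
  shows "(Bs_Hurewicz \<BB> \<longleftrightarrow> S_fin (open_Bs_covers \<BB>) (Bs_groupable_covers \<BB>)) \<and>
         (S_fin (open_Bs_covers \<BB>) (Bs_groupable_covers \<BB>) \<longleftrightarrow>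
            \<not> (\<exists>\<sigma>. G_fin_winning_ONE (open_Bs_covers \<BB>) (Bs_groupable_covers \<BB>) \<sigma>))"
proof -
  have "\<not> (\<exists>\<sigma>. G_fin_winning_ONE (open_Bs_covers \<BB>) (Bs_groupable_covers \<BB>) \<sigma>)"
    if "Bs_Hurewicz \<BB>"
    using TWO_beats_strategy_if_Bs_Hurewicz[OF assms(2) that]
    unfolding G_fin_winning_ONE_def by metis
  then show ?thesis
    using S_fin_if_no_winning_strategy Bs_Hurewicz_if_S_fin[OF assms(2)] by blast
qed

end
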